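(* For every integer $n\ge 0$, $$\beta_{n,\lambda}=\sum_{k=0}^{n}\frac{(-1)^{k}}{k+1}\,k!\,S_{2,\lambda}(n,k)=\sum_{k=0}^{n}\frac{1}{k+1}\sum_{j=0}^{k}\binom{k}{j}(-1)^{j}(j)_{n,\lambda}.$$
   Context: Let $\lambda\in\mathbb{R}$. The degenerate falling factorial is $(x)_{0,\lambda}=1$, $(x)_{n,\lambda}=x(x-\lambda)\cdots(x-(n-1)\lambda)$ for $n\ge1$; the ordinary falling factorial is $(x)_0=1$, $(x)_n=x(x-1)\cdots(x-n+1)$. The degenerate exponential is the formal power series $e_\lambda^x(t)=\sum_{k\ge0}(x)_{k,\lambda}t^k/k!$ and $e_\lambda(t)=e_\lambda^1(t)$. The fully degenerate Bernoulli polynomials $\beta_{n,\lambda}(x)$ are defined by $\frac{\log(1+\lambda t)}{\lambda(e_\lambda(t)-1)}e_\lambda^x(t)=\sum_{n\ge0}\beta_{n,\lambda}(x)\frac{t^n}{n!}$ (for $\lambda=0$ interpret $\log(1+\lambda t)/\lambda$ as $t$ and $e_0^x(t)=e^{xt}$), and $\beta_{n,\lambda}=\beta_{n,\lambda}(0)$ are the fully degenerate Bernoulli numbers. The degenerate Stirling numbers of the second kind $S_{2,\lambda}(n,k)$ are defined by $(x)_{n,\lambda}=\sum_{k=0}^{n}S_{2,\lambda}(n,k)(x)_k$ for $n\ge0$; equivalently $\frac{1}{k!}(e_\lambda(t)-1)^k=\sum_{n\ge k}S_{2,\lambda}(n,k)\frac{t^n}{n!}$. *)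

theory Defs
  imports Complex_Main "HOL-Computational_Algebra.Formal_Power_Series"
begin

definition falling_fact :: "real \<Rightarrow> nat \<Rightarrow> real" where
  "falling_fact x n = (\<Prod>i<n. x - real i)"

definition deg_falling_fact :: "real \<Rightarrow> real \<Rightarrow> nat \<Rightarrow> real" where
  "deg_falling_fact lam x n = (\<Prod>i<n. x - real i * lam)"

definition deg_exp :: "real \<Rightarrow> real \<Rightarrow> real fps" where
  "deg_exp lam x = Abs_fps (\<lambda>k. deg_falling_fact lam x k / fact k)"

text \<open>The series \<open>log (1 + lam t) / lam\<close>, read as \<open>t\<close> when \<open>lam = 0\<close>; note that
  \<open>fps_ln 1\<close> is the series of \<open>log (1 + t)\<close>.\<close>

definition deg_log :: "real \<Rightarrow> real fps" where
  "deg_log lam = (if lam = 0 then fps_X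
     else fps_const (1 / lam) * fps_compose (fps_ln 1) (fps_const lam * fps_X))"

text \<open>Numerator and denominator of the quotient below both have zero constant term, and the
  denominator has subdegree 1, so the division of power series is exact
  (see \<open>deg_log_divide_exact\<close>).\<close>

definition full_deg_bernoulli_poly :: "real \<Rightarrow> nat \<Rightarrow> real \<Rightarrow> real" where
  "full_deg_bernoulli_poly lam n x =
     fact n * fps_nth (deg_log lam / (deg_exp lam 1 - 1) * deg_exp lam x) n"

definition full_deg_bernoulli :: "real \<Rightarrow> nat \<Rightarrow> real" where
  "full_deg_bernoulli lam n = full_deg_bernoulli_poly lam n 0"

text \<open>The defining identity fixes \<open>S n k\<close> for \<open>k \<le> n\<close> only; the remaining values are set to 0.
  Existence and uniqueness are shown in \<open>deg_stirling2_ex1\<close>.\<close>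

definition deg_stirling2 :: "real \<Rightarrow> nat \<Rightarrow> nat \<Rightarrow> real" where
  "deg_stirling2 lam = (THE S. (\<forall>n k. k > n \<longrightarrow> S n k = 0) \<and>
     (\<forall>n x. deg_falling_fact lam x n = (\<Sum>k=0..n. S n k * falling_fact x k)))"

lemma deg_exp_0: "deg_exp 0 x = fps_exp x"
  by (simp add: deg_exp_def deg_falling_fact_def fps_eq_iff)

lemma deg_log_divide_exact:
  "deg_log lam / (deg_exp lam 1 - 1) * (deg_exp lam 1 - 1) = deg_log lam"
proof -
  let ?g = "deg_exp lam 1 - 1"
  have g: "fps_nth ?g 0 = 0" "fps_nth ?g 1 = 1"
    by (simp_all add: deg_exp_def deg_falling_fact_def)
  have g0: "?g \<noteq> 0"
    using g(2) by (metis fps_zero_nth zero_neq_one)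
  have sub: "subdegree ?g = 1"
    by (rule subdegreeI) (use g in auto)
  have "fps_nth (deg_log lam) 0 = 0"
    by (simp add: deg_log_def)
  hence "deg_log lam = 0 \<or> subdegree (deg_log lam) \<ge> 1"
    by (metis One_nat_def Suc_leI gr0I subdegree_eq_0_iff)
  hence "?g dvd deg_log lam"
    using g0 sub fps_dvd_iff dvd_0_right by metis
  thus ?thesis by simp
qed

lemma falling_fact_nat_less: "m < k \<Longrightarrow> falling_fact (real m) k = 0"
  unfolding falling_fact_def by (rule prod_zero) auto

lemma falling_fact_nat_self: "falling_fact (real m) m \<noteq> 0"
  by (auto simp: falling_fact_def)

lemma falling_fact_coeffs_unique:
  assumes eq: "\<And>x. (\<Sum>k=0..n. a k * falling_fact x k) = (\<Sum>k=0..n. b k * falling_fact x k)"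
    and "m \<le> n"
  shows "a m = b m"
  using \<open>m \<le> n\<close>
proof (induction m rule: less_induct)
  case (less m)
  have split: "(\<Sum>k=0..n. c k * falling_fact (real m) k) =
      (\<Sum>k<m. c k * falling_fact (real m) k) + c m * falling_fact (real m) m" for c :: "nat \<Rightarrow> real"
  proof -
    have "(\<Sum>k=0..n. c k * falling_fact (real m) k) = (\<Sum>k\<in>{..<Suc m}. c k * falling_fact (real m) k)"
      using less.prems by (intro sum.mono_neutral_right) (auto simp: falling_fact_nat_less)
    thus ?thesis by simp
  qed
  have "(\<Sum>k<m. a k * falling_fact (real m) k) = (\<Sum>k<m. b k * falling_fact (real m) k)"
    using less by (intro sum.cong) auto
  thus ?case
    using eq[of "real m"] falling_fact_nat_self[of m] by (simp add: split)
qed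

lemma deg_falling_fact_expansion:
  "\<exists>c. (\<forall>k>n. c k = 0) \<and> (\<forall>x. deg_falling_fact lam x n = (\<Sum>k=0..n. c k * falling_fact x k))"
proof (induction n)
  case 0
  show ?case
    by (rule exI[of _ "\<lambda>k. if k = 0 then 1 else 0"])
      (simp add: deg_falling_fact_def falling_fact_def)
next
  case (Suc n)
  then obtain c where c0: "\<And>k. k > n \<Longrightarrow> c k = 0"
    and c: "\<And>x. deg_falling_fact lam x n = (\<Sum>k=0..n. c k * falling_fact x k)"
    by blast
  define d where "d k = (if k = 0 then 0 else c (k - 1)) + (real k - real n * lam) * c k" for k
  have "deg_falling_fact lam x (Suc n) = (\<Sum>k=0..Suc n. d k * falling_fact x k)" for x
  proof -
    have step: "c k * falling_fact x k * (x - real n * lam) =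
        c k * falling_fact x (Suc k) + (real k - real n * lam) * c k * falling_fact x k" for k
      by (simp add: falling_fact_def algebra_simps)
    have "deg_falling_fact lam x (Suc n) = (\<Sum>k=0..n. c k * falling_fact x k * (x - real n * lam))"
      using c[of x] by (simp add: deg_falling_fact_def sum_distrib_right)
    also have "\<dots> = (\<Sum>k=0..n. c k * falling_fact x (Suc k)) +
        (\<Sum>k=0..n. (real k - real n * lam) * c k * falling_fact x k)"
      by (simp add: step sum.distrib)
    also have "(\<Sum>k=0..n. c k * falling_fact x (Suc k)) =
        (\<Sum>k=0..Suc n. (if k = 0 then 0 else c (k - 1)) * falling_fact x k)"
      by (simp only: sum.atLeast0_atMost_Suc_shift) simp
    also have "(\<Sum>k=0..n. (real k - real n * lam) * c k * falling_fact x k) =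
        (\<Sum>k=0..Suc n. (real k - real n * lam) * c k * falling_fact x k)"
      by (simp add: c0)
    finally show ?thesis
      by (simp only: d_def sum.distrib distrib_right)
  qed
  moreover have "\<forall>k>Suc n. d k = 0"
    by (simp add: d_def c0)
  ultimately show ?case by blast
qed

lemma deg_stirling2_ex1:
  "\<exists>!S. (\<forall>n k. k > n \<longrightarrow> S n k = 0) \<and>
     (\<forall>n x. deg_falling_fact lam x n = (\<Sum>k=0..n. S n k * falling_fact x k))"
proof (rule ex_ex1I)
  have "\<forall>n. \<exists>c. (\<forall>k>n. c k = 0) \<and>
      (\<forall>x. deg_falling_fact lam x n = (\<Sum>k=0..n. c k * falling_fact x k))"
    using deg_falling_fact_expansion by blast
  from choice[OF this] show "\<exists>S. (\<forall>n k. k > n \<longrightarrow> S n k = 0) \<and>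
      (\<forall>n x. deg_falling_fact lam x n = (\<Sum>k=0..n. S n k * falling_fact x k))"
    by blast
next
  fix S T :: "nat \<Rightarrow> nat \<Rightarrow> real"
  assume S: "(\<forall>n k. k > n \<longrightarrow> S n k = 0) \<and>
      (\<forall>n x. deg_falling_fact lam x n = (\<Sum>k=0..n. S n k * falling_fact x k))"
    and T: "(\<forall>n k. k > n \<longrightarrow> T n k = 0) \<and>
      (\<forall>n x. deg_falling_fact lam x n = (\<Sum>k=0..n. T n k * falling_fact x k))"
  have "S n k = T n k" for n k
  proof (cases "k \<le> n")
    case True
    have "(\<Sum>k=0..n. S n k * falling_fact x k) = (\<Sum>k=0..n. T n k * falling_fact x k)" for x
      using S T by metis
    from falling_fact_coeffs_unique[OF this True] show ?thesis .
  next
    case False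
    thus ?thesis using S T by simp
  qed
  thus "S = T" by blast
qed

lemma deg_stirling2_expansion:
  "deg_falling_fact lam x n = (\<Sum>k=0..n. deg_stirling2 lam n k * falling_fact x k)"
  using theI'[OF deg_stirling2_ex1[of lam]] unfolding deg_stirling2_def by blast

end

theory Submission
  imports Defs
begin

text \<open>Put \<open>u = e\<^sub>\<lambda>(t) - 1\<close>. The series \<open>e\<^sub>\<lambda>\<^sup>x(t)\<close> is the solution of
  \<open>(1 + \<lambda>t) f' = x f\<close>, \<open>f(0) = 1\<close>; hence \<open>log (1 + \<lambda>t) / \<lambda> = log (1 + u)\<close> and
  \<open>e\<^sub>\<lambda>(t)^j = e\<^sub>\<lambda>\<^sup>j(t)\<close>. Dividing by \<open>u\<close>, the generating function of the fully degenerate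
  Bernoulli numbers is \<open>\<Sum>k. (-1)^k u^k / (k + 1)\<close>, and expanding \<open>(-u)^k = (1 - e\<^sub>\<lambda>(t))^k\<close>
  binomially gives the double sum. The inner sum is a \<open>k\<close>-th finite difference at \<open>0\<close>, so it
  extracts \<open>(-1)^k k! S\<^sub>2(n, k)\<close> from the expansion in falling factorials.\<close>

unbundle fps_syntax

lemma deg_exp_nth_Suc:
  "deg_exp lam x $ Suc n * (real n + 1) = (x - real n * lam) * deg_exp lam x $ n"
proof -
  have "1 + real n \<noteq> 0"
    by linarith
  thus ?thesis
    by (simp add: deg_exp_def deg_falling_fact_def divide_simps)
qed

text \<open>Reads the differential equation coefficientwise, turning it into a first-order
  recurrence.\<close>

lemma one_plus_const_X_mult_deriv_nth:
  fixes f :: "real fps"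
  shows "((1 + fps_const c * fps_X) * fps_deriv f) $ n =
    f $ Suc n * (real n + 1) + real n * c * f $ n"
  by (cases n) (simp_all add: algebra_simps)

lemma deg_exp_deriv:
  "(1 + fps_const lam * fps_X) * fps_deriv (deg_exp lam x) = fps_const x * deg_exp lam x"
proof (rule fps_ext)
  fix n
  show "((1 + fps_const lam * fps_X) * fps_deriv (deg_exp lam x)) $ n =
      (fps_const x * deg_exp lam x) $ n"
    by (simp only: one_plus_const_X_mult_deriv_nth deg_exp_nth_Suc) (simp add: algebra_simps)
qed

text \<open>The equation expresses \<open>f $ Suc n * (real n + 1)\<close> through
  \<open>f $ n\<close>, and \<open>real n + 1\<close> is nonzero, so \<open>f $ 0\<close> fixes
  every coefficient.\<close>

lemma deg_exp_unique:
  assumes ode: "(1 + fps_const lam * fps_X) * fps_deriv f = fps_const x * f"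
    and "f $ 0 = 1"
  shows "f = deg_exp lam x"
proof (rule fps_ext)
  fix n
  show "f $ n = deg_exp lam x $ n"
  proof (induction n)
    case 0
    show ?case using assms(2) by (simp add: deg_exp_def deg_falling_fact_def)
  next
    case (Suc n)
    have "f $ Suc n * (real n + 1) = (x - real n * lam) * f $ n"
      using one_plus_const_X_mult_deriv_nth [of lam f n]
      unfolding ode fps_mult_left_const_nth by (simp only: left_diff_distrib)
    also have "\<dots> = deg_exp lam x $ Suc n * (real n + 1)"
      by (simp only: Suc.IH deg_exp_nth_Suc)
    finally show ?case
      by (simp add: add_eq_0_iff)
  qed
qed

lemma deg_exp_nth_0 [simp]: "deg_exp lam x $ 0 = 1"
  by (simp add: deg_exp_def deg_falling_fact_def)

lemma deg_exp_zero [simp]: "deg_exp lam 0 = 1"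
  by (rule deg_exp_unique [symmetric]) simp_all

text \<open>By the product rule the right-hand side solves the equation with parameter
  \<open>x + y\<close>; uniqueness identifies it.\<close>

lemma deg_exp_add: "deg_exp lam (x + y) = deg_exp lam x * deg_exp lam y"
proof (rule deg_exp_unique [symmetric])
  let ?p = "1 + fps_const lam * fps_X"
  have "?p * fps_deriv (deg_exp lam x * deg_exp lam y) =
      (?p * fps_deriv (deg_exp lam x)) * deg_exp lam y +
      deg_exp lam x * (?p * fps_deriv (deg_exp lam y))"
    by (simp add: algebra_simps)
  also have "\<dots> = fps_const (x + y) * (deg_exp lam x * deg_exp lam y)"
    unfolding deg_exp_deriv fps_const_add [symmetric] by (simp only: algebra_simps)
  finally show "?p * fps_deriv (deg_exp lam x * deg_exp lam y) =
      fps_const (x + y) * (deg_exp lam x * deg_exp lam y)" .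
qed simp

lemma deg_exp_power: "deg_exp lam 1 ^ j = deg_exp lam (real j)"
  by (induction j) (simp_all add: deg_exp_add)

lemma deg_log_deriv: "(1 + fps_const lam * fps_X) * fps_deriv (deg_log lam) = 1"
proof (cases "lam = 0")
  case False
  let ?c = "fps_const lam * fps_X"
  \<comment> \<open>The inner derivative \<open>lam\<close> from the chain rule cancels the
    prefactor \<open>1 / lam\<close>.\<close>
  have "fps_deriv (deg_log lam) = inverse (1 + ?c)"
    using False
    by (simp add: deg_log_def fps_compose_deriv fps_ln_deriv fps_inverse_compose
        fps_compose_add_distrib mult.left_commute)
  thus ?thesis
    by (simp add: inverse_mult_eq_1')
qed (simp add: deg_log_def)

lemma deg_log_conv_ln: "deg_log lam = fps_ln 1 oo (deg_exp lam 1 - 1)"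
proof -
  let ?p = "1 + fps_const lam * fps_X" and ?e = "deg_exp lam 1"
  \<comment> \<open>Logarithmic derivative: \<open>inverse (1 + fps_X)\<close> composed with
    \<open>?e - 1\<close> is \<open>inverse ?e\<close>.\<close>
  have "?p * fps_deriv (fps_ln 1 oo (?e - 1)) = inverse ?e * (?p * fps_deriv ?e)"
    by (simp add: fps_compose_deriv fps_ln_deriv fps_inverse_compose
        fps_compose_add_distrib mult.left_commute)
  also have "\<dots> = ?p * fps_deriv (deg_log lam)"
    by (simp add: deg_exp_deriv deg_log_deriv inverse_mult_eq_1)
  finally have "?p * fps_deriv (fps_ln 1 oo (?e - 1)) = ?p * fps_deriv (deg_log lam)" .
  moreover have "?p \<noteq> 0"
  proof
    assume "?p = 0"
    hence "?p $ 0 = 0" by (simp only: fps_zero_nth)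
    thus False by simp
  qed
  ultimately have "fps_deriv (fps_ln 1 oo (?e - 1)) = fps_deriv (deg_log lam)"
    by (simp only: mult_cancel_left) simp
  thus ?thesis
    \<comment> \<open>Equal derivatives leave only the constant terms to compare, and both
      vanish.\<close>
    unfolding fps_deriv_eq_iff by (simp add: deg_log_def)
qed

lemma deg_log_divide:
  "deg_log lam / (deg_exp lam 1 - 1) =
     Abs_fps (\<lambda>k. (-1) ^ k / (real k + 1)) oo (deg_exp lam 1 - 1)"
proof -
  let ?Q = "Abs_fps (\<lambda>k. (-1) ^ k / (real k + 1))" and ?u = "deg_exp lam 1 - 1"
  \<comment> \<open>Splitting off \<open>fps_X\<close> before composing makes \<open>?u\<close> an
    explicit factor of \<open>deg_log lam\<close>, which the division then cancels.\<close>
  have "fps_ln 1 = ?Q * fps_X"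
    by (rule fps_ext) (simp add: fps_ln_nth of_nat_diff)
  hence "deg_log lam = (?Q oo ?u) * ?u"
    by (simp add: deg_log_conv_ln fps_compose_mult_distrib)
  moreover have "?u $ 1 = 1"
    by (simp add: deg_exp_def deg_falling_fact_def)
  hence "?u \<noteq> 0"
    by (metis fps_zero_nth zero_neq_one)
  ultimately show ?thesis
    by simp
qed

lemma one_minus_power_conv_sum:
  fixes f :: "real fps"
  shows "(1 - f) ^ k = (\<Sum>j\<le>k. fps_const (real (k choose j) * (-1) ^ j) * f ^ j)"
proof -
  \<comment> \<open>This order of summands makes \<open>binomial_ring\<close> put the exponent
    \<open>j\<close> on \<open>- f\<close>.\<close>
  have "(1 - f) ^ k = (- f + 1) ^ k"
    by simp
  also have "\<dots> = (\<Sum>j\<le>k. fps_const (real (k choose j) * (-1) ^ j) * f ^ j)"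
    unfolding binomial_ring
    by (intro sum.cong)
      (simp_all add: power_minus [of f] fps_of_nat [symmetric]
        fps_const_mult [symmetric] fps_const_power [symmetric] fps_const_neg [symmetric] mult.assoc
        del: fps_const_power fps_const_neg fps_const_mult)
  finally show ?thesis .
qed

lemma deg_exp_minus_one_power_nth:
  "(-1) ^ k * ((deg_exp lam 1 - 1) ^ k $ n) * fact n =
     (\<Sum>j=0..k. real (k choose j) * (-1) ^ j * deg_falling_fact lam (real j) n)"
proof -
  have "fps_const ((-1) ^ k) * (deg_exp lam 1 - 1) ^ k = (1 - deg_exp lam 1) ^ k"
    by (simp add: fps_const_power [symmetric] power_mult_distrib [symmetric]
        fps_const_neg [symmetric] del: fps_const_power fps_const_neg)
  also have "\<dots> = (\<Sum>j\<le>k. fps_const (real (k choose j) * (-1) ^ j) * deg_exp lam (real j))"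
    by (simp only: one_minus_power_conv_sum deg_exp_power)
  finally have "(-1) ^ k * ((deg_exp lam 1 - 1) ^ k $ n) =
      (\<Sum>j\<le>k. real (k choose j) * (-1) ^ j * deg_exp lam (real j) $ n)"
    by (metis (no_types, lifting) fps_mult_left_const_nth fps_sum_nth sum.cong)
  thus ?thesis
    by (simp add: deg_exp_def sum_distrib_right atLeast0AtMost)
qed

text \<open>The series substituted into has zero constant term, so its powers beyond the
  \<open>n\<close>-th do not reach coefficient \<open>n\<close> and the sum stops at
  \<open>n\<close>.\<close>

lemma full_deg_bernoulli_conv_sum:
  "full_deg_bernoulli lam n = (\<Sum>k=0..n. 1 / (real k + 1) *
     (\<Sum>j=0..k. real (k choose j) * (-1) ^ j * deg_falling_fact lam (real j) n))"
  unfolding full_deg_bernoulli_def full_deg_bernoulli_poly_def deg_log_divide deg_exp_zero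
    mult_1_right deg_exp_minus_one_power_nth [symmetric]
  by (simp add: fps_compose_nth sum_distrib_left mult_ac)

text \<open>Coefficient comparison in \<open>(1 - (1 + X))^k = (-X)^k\<close>.\<close>

lemma sum_choose_choose_alternating:
  "(\<Sum>j\<le>k. real (k choose j) * (-1) ^ j * real (j choose m)) = (if m = k then (-1) ^ k else 0)"
proof -
  have "(\<Sum>j\<le>k. fps_const (real (k choose j) * (-1) ^ j) * (1 + fps_X) ^ j) =
      (1 - (1 + fps_X) :: real fps) ^ k"
    by (simp only: one_minus_power_conv_sum)
  also have "\<dots> = fps_const ((-1) ^ k) * fps_X ^ k"
    by (simp add: power_minus [of fps_X] fps_const_power [symmetric]
        fps_const_neg [symmetric] del: fps_const_power fps_const_neg)
  finally have "(\<Sum>j\<le>k. fps_const (real (k choose j) * (-1) ^ j) * (1 + fps_X) ^ j) $ m =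
      (fps_const ((-1) ^ k) * fps_X ^ k) $ m"
    by simp
  moreover have "(1 + fps_X :: real fps) ^ j $ m = real (j choose m)" for j
    by (simp add: fps_binomial_of_nat [symmetric] binomial_gbinomial)
  ultimately show ?thesis
    by (simp add: fps_sum_nth)
qed

lemma falling_fact_of_nat: "falling_fact (real j) m = fact m * real (j choose m)"
  by (simp add: falling_fact_def binomial_gbinomial gbinomial_prod_rev atLeast0LessThan)

lemma deg_stirling2_conv_sum:
  assumes "k \<le> n"
  shows "(-1) ^ k * fact k * deg_stirling2 lam n k =
    (\<Sum>j=0..k. real (k choose j) * (-1) ^ j * deg_falling_fact lam (real j) n)"
proof -
  have "(\<Sum>j=0..k. real (k choose j) * (-1) ^ j * deg_falling_fact lam (real j) n) =
      (\<Sum>j\<le>k. \<Sum>m=0..n. deg_stirling2 lam n m * fact m *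
        (real (k choose j) * (-1) ^ j * real (j choose m)))"
    unfolding deg_stirling2_expansion falling_fact_of_nat
    by (simp add: sum_distrib_left mult_ac atLeast0AtMost)
  \<comment> \<open>After swapping the sums, the sum over \<open>j\<close> is the alternating one
    that vanishes unless \<open>m = k\<close>; \<open>k \<le> n\<close> keeps that index in
    range.\<close>
  also have "\<dots> = (\<Sum>m=0..n. deg_stirling2 lam n m * fact m * (if m = k then (-1) ^ k else 0))"
    by (subst sum.swap) (simp only: sum_distrib_left [symmetric] sum_choose_choose_alternating)
  also have "\<dots> = (-1) ^ k * fact k * deg_stirling2 lam n k"
    using assms by (simp add: if_distrib cong: if_cong)
  finally show ?thesis ..
qed

theorem theorem1:
  fixes lam :: real and n :: nat
  shows "full_deg_bernoulli lam n =
           (\<Sum>k=0..n. (-1) ^ k / (real k + 1) * fact k * deg_stirling2 lam n k) \<and>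
         (\<Sum>k=0..n. (-1) ^ k / (real k + 1) * fact k * deg_stirling2 lam n k) =
           (\<Sum>k=0..n. 1 / (real k + 1) *
             (\<Sum>j=0..k. real (k choose j) * (-1) ^ j * deg_falling_fact lam (real j) n))"
proof -
  have "(\<Sum>k=0..n. (-1) ^ k / (real k + 1) * fact k * deg_stirling2 lam n k) =
      (\<Sum>k=0..n. 1 / (real k + 1) *
        (\<Sum>j=0..k. real (k choose j) * (-1) ^ j * deg_falling_fact lam (real j) n))"
    by (intro sum.cong) (simp_all add: deg_stirling2_conv_sum [symmetric])
  thus ?thesis
    by (simp add: full_deg_bernoulli_conv_sum)
qed

end
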